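(* Let $ABCD$ be a quadrangle in the Euclidean plane whose diagonals $AC$ and $BD$ are not parallel. Then for every $\lambda\in\mathbb{R}$ the four lines $A_D^{\lambda}A_B^{\lambda}$, $B_A^{\lambda}B_C^{\lambda}$, $C_B^{\lambda}C_D^{\lambda}$, $D_C^{\lambda}D_A^{\lambda}$ form a parallelogram (for $\lambda=1$ a degenerate one, consisting only of the intersection point $O$ of the lines $AC$ and $BD$). Here "form a parallelogram" means that consecutive lines in this cyclic list intersect in exactly one point, and that these four intersection points, taken in cyclic order, are the vertices of a parallelogram.
   Context: A quadrangle $ABCD$ consists of four points $A,B,C,D$ of the Euclidean plane, no three collinear, taken in this cyclic order; its sides are the segments $AB,BC,CD,DA$, and it may be convex, re-entrant (non-convex and not self-intersecting) or crossed (self-intersecting). The lines $AC$ and $BD$ are its diagonals. For points $X,Y$ and $\lambda\in\mathbb{R}$, $X_Y^{\lambda}$ denotes the image of $Y$ under the homothety with center $X$ and ratio $\lambda$, i.e. $X_Y^{\lambda}=X+\lambda(Y-X)$. Convention for $\lambda=0$: the two points defining each line coincide, and the lines are understood as limits as $\lambda\to0$: $A_D^{0}A_B^{0}$ is the line through $A$ parallel to $BD$, $B_A^{0}B_C^{0}$ the line through $B$ parallel to $AC$, $C_B^{0}C_D^{0}$ the line through $C$ parallel to $BD$, $D_C^{0}D_A^{0}$ the line through $D$ parallel to $AC$. *)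

theory Defs
  imports "HOL-Analysis.Analysis"
begin

definition quadrangle :: "real^2 \<Rightarrow> real^2 \<Rightarrow> real^2 \<Rightarrow> real^2 \<Rightarrow> bool" where
  "quadrangle A B C D \<longleftrightarrow>
     \<not> collinear {A, B, C} \<and> \<not> collinear {B, C, D} \<and>
     \<not> collinear {C, D, A} \<and> \<not> collinear {D, A, B}"

definition line_through :: "real^2 \<Rightarrow> real^2 \<Rightarrow> (real^2) set" where
  "line_through X Y = affine hull {X, Y}"

definition parallel_through :: "real^2 \<Rightarrow> real^2 \<Rightarrow> real^2 \<Rightarrow> (real^2) set" where
  "parallel_through X Y Z = (\<lambda>p. (X - Y) + p) ` line_through Y Z"

definition homothety :: "real^2 \<Rightarrow> real \<Rightarrow> real^2 \<Rightarrow> real^2" where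
  "homothety X l Y = X + l *\<^sub>R (Y - X)"

text \<open>The line joining the images of \<open>Y\<close> and \<open>Z\<close> under the homothety with center \<open>X\<close> and
  ratio \<open>l\<close>. For \<open>l = 0\<close> both images equal \<open>X\<close>, and the line is taken to be its limit
  as \<open>l\<close> tends to \<open>0\<close>, the parallel to \<open>YZ\<close> through \<open>X\<close>.\<close>

definition homothetic_line :: "real^2 \<Rightarrow> real \<Rightarrow> real^2 \<Rightarrow> real^2 \<Rightarrow> (real^2) set" where
  "homothetic_line X l Y Z =
     (if l = 0 then parallel_through X Y Z
      else line_through (homothety X l Y) (homothety X l Z))"

text \<open>A nondegenerate parallelogram, with vertices in cyclic order.\<close>

definition parallelogram :: "real^2 \<Rightarrow> real^2 \<Rightarrow> real^2 \<Rightarrow> real^2 \<Rightarrow> bool" where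
  "parallelogram P Q R S \<longleftrightarrow> quadrangle P Q R S \<and>
     affine_parallel (line_through P Q) (line_through R S) \<and>
     affine_parallel (line_through Q R) (line_through S P)"

end

theory Submission
  imports Defs
begin

text \<open>Take the intersection point \<open>p\<close> of the diagonals as origin and directions \<open>u\<close>, \<open>v\<close> of
  \<open>AC\<close>, \<open>BD\<close> as axes. The line through the images of \<open>D\<close> and \<open>B\<close> under the homothety with
  center \<open>A = p + a u\<close> is then \<open>{p + (1 - \<lambda>) a u + t v | t}\<close>, for \<open>\<lambda> = 0\<close> as well, and
  likewise for the other three. So the four lines bound the image, under the homothety with center
  \<open>p\<close> and ratio \<open>1 - \<lambda>\<close>, of the parallelogram formed by the parallels to the diagonals
  through the vertices.\<close>

text \<open>The affine combination with weight \<open>s\<close> lies at parameter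
  \<open>x + s * (y - x)\<close>, and this runs through all reals because
  \<open>x \<noteq> y\<close>.\<close>

lemma line_through_eq:
  assumes "x \<noteq> y"
  shows "line_through (p + x *\<^sub>R w) (p + y *\<^sub>R w) = range (\<lambda>t. p + t *\<^sub>R w)"
proof -
  have "p + (x + s * (y - x)) *\<^sub>R w = (1 - s) *\<^sub>R (p + x *\<^sub>R w) + s *\<^sub>R (p + y *\<^sub>R w)" for s
    by (simp add: algebra_simps)
  then have "line_through (p + x *\<^sub>R w) (p + y *\<^sub>R w)
      = (\<lambda>t. p + t *\<^sub>R w) ` range (\<lambda>s. x + s * (y - x))"
    unfolding line_through_def affine_hull_2_alt
    by (simp add: image_image algebra_simps)
  moreover have "range (\<lambda>s. x + s * (y - x)) = UNIV"
    using assms by (intro surjI[where f = "\<lambda>t. (t - x) / (y - x)"]) simp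
  ultimately show ?thesis
    by simp
qed

text \<open>Both lines have direction \<open>Q - P\<close>, so translation by \<open>R - P\<close>
  carries one to the other; \<open>k \<noteq> 0\<close> keeps \<open>R S\<close> from shrinking to a
  point when \<open>P \<noteq> Q\<close>.\<close>

lemma affine_parallel_line_through:
  assumes "S - R = k *\<^sub>R (Q - P)" "k \<noteq> 0"
  shows "affine_parallel (line_through P Q) (line_through R S)"
proof -
  have "line_through P Q = range (\<lambda>t. P + t *\<^sub>R (Q - P))"
    using line_through_eq[of 0 1 P "Q - P"] by simp
  moreover have "line_through R S = range (\<lambda>t. R + t *\<^sub>R (Q - P))"
    using line_through_eq[of 0 k R "Q - P"] assms(2) by (simp flip: assms(1))
  ultimately have "line_through R S = (\<lambda>x. (R - P) + x) ` line_through P Q"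
    by (simp add: image_image)
  then show ?thesis
    unfolding affine_parallel_def by blast
qed

lemma homothetic_line_eq:
  assumes "b \<noteq> d"
  shows "homothetic_line (p + a *\<^sub>R u) l (p + b *\<^sub>R v) (p + d *\<^sub>R v)
    = range (\<lambda>t. (p + ((1 - l) * a) *\<^sub>R u) + t *\<^sub>R v)"
proof (cases "l = 0")
  case True
  \<comment> \<open>The limiting line is \<open>Y Z\<close> translated so that \<open>Y\<close>
    falls on the center. With \<open>Y\<close> at parameter \<open>b\<close>, this shifts the
    parameter by \<open>b\<close>, which leaves the range unchanged.\<close>
  have "surj (\<lambda>t. t - b)"
    by (rule surjI[where f = "\<lambda>t. t + b"]) simp
  then have "range (\<lambda>t. (p + a *\<^sub>R u) + t *\<^sub>R v)
      = (\<lambda>t. (p + a *\<^sub>R u) + t *\<^sub>R v) ` range (\<lambda>t. t - b)"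
    by simp
  also have "\<dots> = range (\<lambda>t. (p + a *\<^sub>R u) + (t - b) *\<^sub>R v)"
    by (simp only: image_image)
  also have "\<dots> = homothetic_line (p + a *\<^sub>R u) l (p + b *\<^sub>R v) (p + d *\<^sub>R v)"
    using True line_through_eq[OF assms, of p v]
    by (simp add: homothetic_line_def parallel_through_def image_image algebra_simps)
  finally show ?thesis
    using True by simp
next
  case False
  \<comment> \<open>The \<open>u\<close> coordinate of the image does not depend on
    \<open>x\<close>, and the \<open>v\<close> coordinates \<open>l * b\<close> and
    \<open>l * d\<close> stay distinct because \<open>l \<noteq> 0\<close>.\<close>
  have "homothety (p + a *\<^sub>R u) l (p + x *\<^sub>R v) = (p + ((1 - l) * a) *\<^sub>R u) + (l * x) *\<^sub>R v" for x
    by (simp add: homothety_def algebra_simps)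
  with False assms show ?thesis
    by (simp add: homothetic_line_def line_through_eq)
qed

lemma Int_lines:
  fixes p u v :: "'a::real_vector"
  assumes indep: "\<And>s t. s *\<^sub>R u + t *\<^sub>R v = 0 \<Longrightarrow> s = 0 \<and> t = 0"
  shows "range (\<lambda>t. (p + x *\<^sub>R u) + t *\<^sub>R v) \<inter> range (\<lambda>t. (p + y *\<^sub>R v) + t *\<^sub>R u)
    = {p + x *\<^sub>R u + y *\<^sub>R v}"
proof -
  have "t = y" if "(p + x *\<^sub>R u) + t *\<^sub>R v = (p + y *\<^sub>R v) + s *\<^sub>R u" for s t
    using indep[of "x - s" "t - y"] that by (simp add: algebra_simps)
  moreover have "p + x *\<^sub>R u + y *\<^sub>R v = (p + y *\<^sub>R v) + x *\<^sub>R u"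
    by (simp add: algebra_simps)
  ultimately show ?thesis
    by blast
qed

text \<open>Seen from the middle point \<open>y\<close>, the other two points lie in independent
  directions.\<close>

lemma not_collinear_offset:
  assumes indep: "\<And>s t. s *\<^sub>R u + t *\<^sub>R v = 0 \<Longrightarrow> s = 0 \<and> t = 0"
    and "x - y = r *\<^sub>R u" "z - y = q *\<^sub>R v" "r \<noteq> 0" "q \<noteq> 0"
  shows "\<not> collinear {x, y, z}"
proof
  assume "collinear {x, y, z}"
  then have "collinear {0, r *\<^sub>R u, q *\<^sub>R v}"
    using assms(2,3) by (simp add: collinear_3)
  then consider "r *\<^sub>R u = 0" | "q *\<^sub>R v = 0" | c where "q *\<^sub>R v = (c * r) *\<^sub>R u"
    by (auto simp: collinear_lemma)
  then show False
  proof cases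
    case (3 c)
    then show False
      using indep[of "c * r" "- q"] assms(5) by simp
  qed (use indep[of r 0] indep[of 0 q] assms(4,5) in auto)
qed

lemma parallelogram_of_directions:
  assumes indep: "\<And>s t. s *\<^sub>R u + t *\<^sub>R v = 0 \<Longrightarrow> s = 0 \<and> t = 0"
    and "x \<noteq> x'" "y \<noteq> y'"
  shows "parallelogram (p + x *\<^sub>R u + y *\<^sub>R v) (p + x' *\<^sub>R u + y *\<^sub>R v)
    (p + x' *\<^sub>R u + y' *\<^sub>R v) (p + x *\<^sub>R u + y' *\<^sub>R v)"
    (is "parallelogram ?P ?Q ?R ?S")
proof -
  \<comment> \<open>The sides run alternately along \<open>u\<close> and \<open>v\<close>, so at
    every second vertex the two directions swap roles.\<close>
  have indep': "s = 0 \<and> t = 0" if "s *\<^sub>R v + t *\<^sub>R u = 0" for s t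
    using indep[of t s] that by (simp add: add.commute)
  have "\<not> collinear {?P, ?Q, ?R}"
    by (rule not_collinear_offset[OF indep, where r = "x - x'" and q = "y' - y"])
       (use assms in \<open>auto simp: algebra_simps\<close>)
  moreover have "\<not> collinear {?Q, ?R, ?S}"
    by (rule not_collinear_offset[OF indep', where r = "y - y'" and q = "x - x'"])
       (use assms in \<open>auto simp: algebra_simps\<close>)
  moreover have "\<not> collinear {?R, ?S, ?P}"
    by (rule not_collinear_offset[OF indep, where r = "x' - x" and q = "y - y'"])
       (use assms in \<open>auto simp: algebra_simps\<close>)
  moreover have "\<not> collinear {?S, ?P, ?Q}"
    by (rule not_collinear_offset[OF indep', where r = "y' - y" and q = "x' - x"])
       (use assms in \<open>auto simp: algebra_simps\<close>)
  moreover have "affine_parallel (line_through ?P ?Q) (line_through ?R ?S)"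
    "affine_parallel (line_through ?Q ?R) (line_through ?S ?P)"
    \<comment> \<open>Opposite sides, traversed in cyclic order, are opposite vectors.\<close>
    by (rule affine_parallel_line_through[where k = "-1"]; simp add: algebra_simps)+
  ultimately show ?thesis
    by (simp add: parallelogram_def quadrangle_def)
qed

text \<open>Two independent vectors span the plane, since its dimension is 2.\<close>

lemma plane_decomposition:
  fixes u v w :: "real^2"
  assumes indep: "\<And>s t. s *\<^sub>R u + t *\<^sub>R v = 0 \<Longrightarrow> s = 0 \<and> t = 0"
  obtains s t where "w = s *\<^sub>R u + t *\<^sub>R v"
proof -
  have "u \<noteq> v"
    using indep[of 1 "-1"] by auto
  moreover have "v \<noteq> 0"
    using indep[of 0 1] by auto
  moreover have "u \<noteq> k *\<^sub>R v" for k
    using indep[of 1 "- k"] by auto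
  ultimately have "independent {u, v}" "card {u, v} = 2"
    by (auto simp: independent_insert span_singleton)
  then have "span {u, v} = UNIV"
    using card_ge_dim_independent[of "{u, v}" UNIV] by auto
  then have "w \<in> span {u, v}"
    by simp
  then obtain s t where "w - s *\<^sub>R u = t *\<^sub>R v"
    by (auto simp: span_insert span_singleton)
  then show thesis
    using that[of s t] by (simp add: algebra_simps)
qed

theorem theorem1:
  fixes A B C D :: "real^2" and l :: real
  assumes "quadrangle A B C D"
    and "\<not> affine_parallel (line_through A C) (line_through B D)"
  shows "\<exists>P Q R S.
      homothetic_line A l D B \<inter> homothetic_line B l A C = {P} \<and>
      homothetic_line B l A C \<inter> homothetic_line C l B D = {Q} \<and>
      homothetic_line C l B D \<inter> homothetic_line D l C A = {R} \<and>
      homothetic_line D l C A \<inter> homothetic_line A l D B = {S} \<and>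
      (l \<noteq> 1 \<longrightarrow> parallelogram P Q R S) \<and>
      (l = 1 \<longrightarrow> (\<exists>O'. line_through A C \<inter> line_through B D = {O'} \<and>
                     P = O' \<and> Q = O' \<and> R = O' \<and> S = O'))"
proof -
  define u v where "u = C - A" and "v = D - B"
  have "u \<noteq> 0" "v \<noteq> 0"
    using assms(1) by (auto simp: quadrangle_def u_def v_def insert_commute)
  \<comment> \<open>Such a \<open>k\<close> would be nonzero, as \<open>v \<noteq> 0\<close>, and
    would make the diagonals parallel.\<close>
  have not_multiple: "v \<noteq> k *\<^sub>R u" for k
    using affine_parallel_line_through[of D B k C A] assms(2) \<open>v \<noteq> 0\<close>
    by (cases "k = 0") (auto simp: u_def v_def)
  have indep: "s = 0 \<and> t = 0" if "s *\<^sub>R u + t *\<^sub>R v = 0" for s t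
  proof -
    have "t = 0"
    proof (rule ccontr)
      assume "t \<noteq> 0"
      have "t *\<^sub>R v = (- s) *\<^sub>R u"
        using that by (simp add: eq_neg_iff_add_eq_0 add.commute)
      then have "inverse t *\<^sub>R t *\<^sub>R v = (inverse t * - s) *\<^sub>R u"
        by simp
      with \<open>t \<noteq> 0\<close> have "v = (inverse t * - s) *\<^sub>R u"
        by simp
      with not_multiple show False
        by blast
    qed
    with that \<open>u \<noteq> 0\<close> show ?thesis
      by simp
  qed
  obtain a e where "A - B = a *\<^sub>R u + e *\<^sub>R v"
    using plane_decomposition[OF indep] by blast
  \<comment> \<open>Rearranging the decomposition gives
    \<open>A - a *\<^sub>R u = B + e *\<^sub>R v\<close>, a point on both diagonals. As
    \<open>u\<close> and \<open>v\<close> are the full diagonal vectors, \<open>C\<close> and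
    \<open>D\<close> get the coordinates \<open>a + 1\<close> and \<open>b + 1\<close>.\<close>
  define p b where "p = A - a *\<^sub>R u" and "b = - e"
  have A: "A = p + a *\<^sub>R u" and C: "C = p + (a + 1) *\<^sub>R u"
    by (simp_all add: p_def u_def algebra_simps)
  have B: "B = p + b *\<^sub>R v" and D: "D = p + (b + 1) *\<^sub>R v"
    using \<open>A - B = _\<close> by (simp_all add: p_def b_def v_def algebra_simps)
  define m where "m = 1 - l"
  have lines:
    "homothetic_line A l D B = range (\<lambda>t. (p + (m * a) *\<^sub>R u) + t *\<^sub>R v)"
    "homothetic_line B l A C = range (\<lambda>t. (p + (m * b) *\<^sub>R v) + t *\<^sub>R u)"
    "homothetic_line C l B D = range (\<lambda>t. (p + (m * (a + 1)) *\<^sub>R u) + t *\<^sub>R v)"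
    "homothetic_line D l C A = range (\<lambda>t. (p + (m * (b + 1)) *\<^sub>R v) + t *\<^sub>R u)"
    unfolding A B C D m_def by (rule homothetic_line_eq; simp)+
  let ?V = "\<lambda>x y. p + (m * x) *\<^sub>R u + (m * y) *\<^sub>R v"
  have "homothetic_line A l D B \<inter> homothetic_line B l A C = {?V a b}"
    "homothetic_line B l A C \<inter> homothetic_line C l B D = {?V (a + 1) b}"
    "homothetic_line C l B D \<inter> homothetic_line D l C A = {?V (a + 1) (b + 1)}"
    "homothetic_line D l C A \<inter> homothetic_line A l D B = {?V a (b + 1)}"
    \<comment> \<open>The second and fourth intersections list the line of direction
      \<open>u\<close> first and need commuting.\<close>
    unfolding lines by (rule Int_lines[OF indep] trans[OF Int_commute Int_lines[OF indep]]; assumption)+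
  \<comment> \<open>Opposite lines differ by the offset \<open>m * (a + 1) - m * a = m\<close>, or
    likewise with \<open>b\<close>, and \<open>m = 1 - l\<close> is nonzero.\<close>
  moreover have "parallelogram (?V a b) (?V (a + 1) b) (?V (a + 1) (b + 1)) (?V a (b + 1))"
    if "l \<noteq> 1"
    by (rule parallelogram_of_directions[OF indep]) (use that in \<open>auto simp: m_def\<close>)
  moreover have "line_through A C \<inter> line_through B D = {p}"
  proof -
    have "line_through A C = range (\<lambda>t. p + t *\<^sub>R u)" "line_through B D = range (\<lambda>t. p + t *\<^sub>R v)"
      unfolding A B C D by (rule line_through_eq; simp)+
    then show ?thesis
      \<comment> \<open>The diagonals themselves are the lines with zero offset.\<close>
      using Int_lines[OF indep, where p = p and x = 0 and y = 0] by (simp add: Int_commute)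
  qed
  \<comment> \<open>For \<open>l = 1\<close> the ratio \<open>m\<close> vanishes and all four
    vertices collapse to \<open>p\<close>.\<close>
  moreover have "?V x y = p" if "l = 1" for x y
    using that by (simp add: m_def)
  ultimately show ?thesis
    by (intro exI[of _ "?V a b"] exI[of _ "?V (a + 1) b"] exI[of _ "?V (a + 1) (b + 1)"]
          exI[of _ "?V a (b + 1)"] conjI impI exI[of _ p])
qed

end
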